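(* Let $m$ be an odd positive integer, $n$ an even integer, and $d$ an integer. Then: (a) if $n\geq 4$, then $\tau_{d}(C_n)=2d$ whenever $1\leq d\leq \frac{n}{2}$ (this is the case $m=1$, as $P_1\square C_n\cong C_n$); (b) if $m\geq 3$ and $n\geq 4$, then $\tau_{d}(P_m\square C_n)=3d$ whenever $1\leq d\leq n$; (c) if $m\geq 3$ and $n\geq 4$, then $\tau_{d}(P_m\square C_n)=4d-n$ whenever $n+1\leq d\leq \frac{mn}{2}$.
   Context: All graphs are simple, finite and undirected. A matching of a graph $G$ is a set of edges no two of which share an endpoint; a maximum matching is a matching of largest cardinality, and this cardinality is denoted $\nu(G)$. For an integer $d$ with $1\leq d\leq \nu(G)$, a $d$-transversal set of $G$ is a set $T\subseteq E(G)$ such that $|T\cap M|\geq d$ for every maximum matching $M$ of $G$; $\tau_d(G)$ denotes the minimum cardinality of a $d$-transversal set of $G$. $P_m$ is the path with $m$ vertices, $C_n$ is the cycle with $n$ vertices ($n\ge 3$). The Cartesian product $G\square H$ has vertex set $V(G)\times V(H)$, with $(g_1,h_1)$ and $(g_2,h_2)$ adjacent iff either $g_1=g_2$ and $h_1h_2\in E(H)$, or $g_1g_2\in E(G)$ and $h_1=h_2$. *)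

theory Defs
  imports Complex_Main
begin

text \<open>Undirected graphs; an edge is the set of its two endpoints.\<close>

record 'a ugraph =
  verts :: "'a set"
  edges :: "'a set set"

definition simple_graph :: "'a ugraph \<Rightarrow> bool" where
  "simple_graph G \<longleftrightarrow>
     finite (verts G) \<and> (\<forall>e\<in>edges G. e \<subseteq> verts G \<and> card e = 2)"

definition matching :: "'a ugraph \<Rightarrow> 'a set set \<Rightarrow> bool" where
  "matching G M \<longleftrightarrow> M \<subseteq> edges G \<and> (\<forall>e\<in>M. \<forall>f\<in>M. e \<noteq> f \<longrightarrow> e \<inter> f = {})"

definition matching_number :: "'a ugraph \<Rightarrow> nat" where
  "matching_number G = Max {card M | M. matching G M}"

definition maximum_matching :: "'a ugraph \<Rightarrow> 'a set set \<Rightarrow> bool" where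
  "maximum_matching G M \<longleftrightarrow> matching G M \<and> card M = matching_number G"

text \<open>
  The notion is meant for \<open>1 \<le> d \<le> matching_number G\<close>, where \<open>edges G\<close> itself is a
  \<open>d\<close>-transversal. For larger \<open>d\<close> a simple graph has no \<open>d\<close>-transversal, and the
  value of \<open>tau\<close> is then meaningless.
\<close>

definition transversal :: "nat \<Rightarrow> 'a ugraph \<Rightarrow> 'a set set \<Rightarrow> bool" where
  "transversal d G T \<longleftrightarrow>
     T \<subseteq> edges G \<and> (\<forall>M. maximum_matching G M \<longrightarrow> d \<le> card (T \<inter> M))"

definition tau :: "nat \<Rightarrow> 'a ugraph \<Rightarrow> nat" where
  "tau d G = Min {card T | T. transversal d G T}"

definition path_graph :: "nat \<Rightarrow> nat ugraph" where
  "path_graph m = \<lparr>verts = {0..<m}, edges = {{i, i + 1} | i. i + 1 < m}\<rparr>"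

text \<open>Only meaningful for \<open>n \<ge> 3\<close>.\<close>

definition cycle_graph :: "nat \<Rightarrow> nat ugraph" where
  "cycle_graph n = \<lparr>verts = {0..<n}, edges = {{i, (i + 1) mod n} | i. i < n}\<rparr>"

definition cartesian_product :: "'a ugraph \<Rightarrow> 'b ugraph \<Rightarrow> ('a \<times> 'b) ugraph"
    (infixr "\<box>" 70) where
  "G \<box> H =
     \<lparr>verts = verts G \<times> verts H,
      edges = {{(g1, h1), (g2, h2)} | g1 h1 g2 h2.
        g1 \<in> verts G \<and> g2 \<in> verts G \<and> h1 \<in> verts H \<and> h2 \<in> verts H \<and>
        (g1 = g2 \<and> {h1, h2} \<in> edges H \<or> {g1, g2} \<in> edges G \<and> h1 = h2)}\<rparr>"

definition graph_isomorphic :: "'a ugraph \<Rightarrow> 'b ugraph \<Rightarrow> bool" where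
  "graph_isomorphic G H \<longleftrightarrow>
     (\<exists>f. bij_betw f (verts G) (verts H) \<and>
       (\<forall>u\<in>verts G. \<forall>v\<in>verts G. {u, v} \<in> edges G \<longleftrightarrow> {f u, f v} \<in> edges H))"

lemma simple_path_graph: "simple_graph (path_graph m)"
  by (auto simp: simple_graph_def path_graph_def)

lemma simple_cycle_graph:
  assumes "n \<ge> 3"
  shows "simple_graph (cycle_graph n)"
proof -
  have "i \<noteq> (i + 1) mod n" if "i < n" for i
    using assms that by (cases "i + 1 = n") auto
  then show ?thesis
    using assms by (auto simp: simple_graph_def cycle_graph_def)
qed

lemma simple_cartesian_product:
  assumes "simple_graph G" "simple_graph H"
  shows "simple_graph (G \<box> H)"
proof -
  have "g1 \<noteq> g2" if "{g1, g2} \<in> edges G" for g1 g2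
    using assms(1) that by (force simp: simple_graph_def)
  moreover have "h1 \<noteq> h2" if "{h1, h2} \<in> edges H" for h1 h2
    using assms(2) that by (force simp: simple_graph_def)
  ultimately show ?thesis
    using assms by (auto simp: simple_graph_def cartesian_product_def card_insert_if)
qed

lemma path_1_cycle_isomorphic:
  "graph_isomorphic (path_graph 1 \<box> cycle_graph n) (cycle_graph n)"
  unfolding graph_isomorphic_def
proof (intro exI conjI ballI)
  show "bij_betw snd (verts (path_graph 1 \<box> cycle_graph n)) (verts (cycle_graph n))"
    by (auto simp: bij_betw_def inj_on_def cartesian_product_def path_graph_def image_iff)
next
  fix u v
  assume uv: "u \<in> verts (path_graph 1 \<box> cycle_graph n)" "v \<in> verts (path_graph 1 \<box> cycle_graph n)"
  then obtain i j where ij: "u = (0, i)" "v = (0, j)"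
      "i \<in> verts (cycle_graph n)" "j \<in> verts (cycle_graph n)"
    by (auto simp: cartesian_product_def path_graph_def)
  then show "{u, v} \<in> edges (path_graph 1 \<box> cycle_graph n) \<longleftrightarrow>
      {snd u, snd v} \<in> edges (cycle_graph n)"
    by (auto simp: cartesian_product_def path_graph_def doubleton_eq_iff insert_commute)
qed

end

theory Submission
  imports Defs
begin

text \<open>
  All graphs here are bipartite, with sides of equal size, and have a perfect matching, so the
  maximum matchings are exactly the perfect ones.

  Upper bounds come from stars. A perfect matching contains exactly one edge at each vertex, and
  for an independent set \<open>S\<close> these edges are distinct; hence the edges that meet \<open>S\<close> form a
  \<open>card S\<close>-transversal (\<open>transversal_stars\<close>), whose size is at most the sum of the degrees over
  \<open>S\<close>. It pays to take vertices of small degree first. In \<open>C\<^sub>n\<close> every degree is 2. In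
  \<open>P\<^sub>m \<box> C\<^sub>n\<close> the two boundary rows have degree 3, and as \<open>m\<close> is odd, one colour class contains
  \<open>n / 2\<close> vertices of each of them: the first \<open>n\<close> units of \<open>d\<close> cost 3 edges each, and
  every further unit costs 4.

  Lower bounds come from packing perfect matchings. If \<open>k\<close> of them are pairwise disjoint, then every
  \<open>d\<close>-transversal has at least \<open>k * d\<close> edges. The cycle has two disjoint perfect matchings. The
  grid has three: two built from column edges, completed by a perfect matching of the last
  or of the first row, and one that uses row edges only. The other perfect matching that uses row
  edges only is a fourth, which meets the first three in \<open>n / 2\<close> edges of each
  boundary row; counting all four gives \<open>4 * d \<le> card T + n\<close>.

  Perfect matchings are handled through the map that sends every vertex to its partner, which
  turns all questions on disjointness into pointwise comparisons of such maps.
\<close>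

section \<open>Perfect matchings and transversals\<close>

definition perfect_matching :: "'a ugraph \<Rightarrow> 'a set set \<Rightarrow> bool" where
  "perfect_matching G M \<longleftrightarrow> matching G M \<and> \<Union>M = verts G"

definition star :: "'a ugraph \<Rightarrow> 'a \<Rightarrow> 'a set set" where
  "star G v = {e \<in> edges G. v \<in> e}"

lemma finite_edges: "simple_graph G \<Longrightarrow> finite (edges G)"
  by (rule finite_subset[of _ "Pow (verts G)"]) (auto simp: simple_graph_def)

lemma finite_matching: "simple_graph G \<Longrightarrow> matching G M \<Longrightarrow> finite M"
  by (meson finite_edges finite_subset matching_def)

lemma card_Union_matching:
  assumes "simple_graph G" "matching G M"
  shows "card (\<Union>M) = 2 * card M"
proof -
  have "card (\<Union>M) = (\<Sum>e\<in>M. card e)"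
  proof (rule card_Union_disjoint)
    show "pairwise disjnt M"
      using assms(2) by (auto simp: pairwise_def disjnt_def matching_def)
    show "\<And>e. e \<in> M \<Longrightarrow> finite e"
      using assms by (meson finite_subset matching_def simple_graph_def subsetD)
  qed
  also have "\<dots> = (\<Sum>e\<in>M. 2)"
    using assms by (intro sum.cong) (auto simp: matching_def simple_graph_def)
  finally show ?thesis by simp
qed

lemma Union_matching_subset: "simple_graph G \<Longrightarrow> matching G M \<Longrightarrow> \<Union>M \<subseteq> verts G"
  by (auto simp: matching_def simple_graph_def)

lemma maximum_iff_perfect_matching:
  assumes G: "simple_graph G" and P: "perfect_matching G P"
  shows "maximum_matching G M \<longleftrightarrow> perfect_matching G M"
proof -
  have fin: "finite (verts G)" using G by (simp add: simple_graph_def)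
  have le: "card N \<le> card P" if N: "matching G N" for N
  proof -
    have "2 * card N = card (\<Union>N)"
      using card_Union_matching[OF G N] by simp
    also have "\<dots> \<le> card (\<Union>P)"
      using card_mono[OF fin Union_matching_subset[OF G N]] P by (simp add: perfect_matching_def)
    also have "\<dots> = 2 * card P"
      using card_Union_matching[OF G, of P] P by (simp add: perfect_matching_def)
    finally show ?thesis by simp
  qed
  have "{card N | N. matching G N} \<subseteq> {..card P}" using le by auto
  then have "finite {card N | N. matching G N}" by (rule finite_subset) simp
  then have nu: "matching_number G = card P"
    unfolding matching_number_def
    using le P by (intro Max_eqI) (auto simp: perfect_matching_def)
  have "card M = card P \<longleftrightarrow> \<Union>M = verts G" if M: "matching G M"
  proof -
    have "card M = card P \<longleftrightarrow> card (\<Union>M) = card (verts G)"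
      using card_Union_matching[OF G M] card_Union_matching[OF G, of P] P
      by (simp add: perfect_matching_def)
    also have "\<dots> \<longleftrightarrow> \<Union>M = verts G"
      using card_subset_eq[OF fin Union_matching_subset[OF G M]] by auto
    finally show ?thesis .
  qed
  then show ?thesis
    by (auto simp: maximum_matching_def perfect_matching_def nu)
qed

lemma transversal_perfect_matching:
  assumes "simple_graph G" "perfect_matching G M" "transversal d G T"
  shows "d \<le> card (T \<inter> M)"
  using assms maximum_iff_perfect_matching[of G M M] by (simp add: transversal_def)

text \<open>
  An upper bound on \<open>card T\<close> suffices, as the lower bound applies to \<open>T\<close> too; unions of stars
  therefore never have to be counted exactly.
\<close>

lemma tau_eqI:
  assumes G: "simple_graph G"
    and T: "transversal d G T" "card T \<le> k"
    and lower: "\<And>U. transversal d G U \<Longrightarrow> k \<le> card U"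
  shows "tau d G = k"
proof -
  have "{card U | U. transversal d G U} \<subseteq> card ` Pow (edges G)"
    by (auto simp: transversal_def)
  then have fin: "finite {card U | U. transversal d G U}"
    by (rule finite_subset) (simp add: finite_edges[OF G])
  have "card T = k" using T lower[OF T(1)] by simp
  then show ?thesis
    unfolding tau_def using fin lower T(1) by (intro Min_eqI) auto
qed

text \<open>
  The edges through which a perfect matching covers an independent set \<open>S\<close> are distinct, so there
  are \<open>card S\<close> of them.
\<close>

lemma transversal_stars:
  assumes G: "simple_graph G" and P: "perfect_matching G P"
    and S: "S \<subseteq> verts G" and indep: "\<And>u v. u \<in> S \<Longrightarrow> v \<in> S \<Longrightarrow> {u, v} \<notin> edges G"
  shows "transversal (card S) G (\<Union>v\<in>S. star G v)"
  unfolding transversal_def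
proof (intro conjI allI impI)
  show "(\<Union>v\<in>S. star G v) \<subseteq> edges G" by (auto simp: star_def)
  fix M assume "maximum_matching G M"
  then have M: "matching G M" "\<Union>M = verts G"
    using maximum_iff_perfect_matching[OF G P] by (auto simp: perfect_matching_def)
  then have "\<forall>v\<in>S. \<exists>e. e \<in> M \<and> v \<in> e" using S by blast
  then obtain h where h: "\<And>v. v \<in> S \<Longrightarrow> h v \<in> M \<and> v \<in> h v" by metis
  have edge: "h v \<in> edges G" if "v \<in> S" for v
    using h[OF that] M(1) by (auto simp: matching_def)
  have "inj_on h S"
  proof (rule inj_onI, rule ccontr)
    fix u v assume uv: "u \<in> S" "v \<in> S" "h u = h v" "u \<noteq> v"
    then have "{u, v} \<subseteq> h u" using h by auto
    moreover have "card (h u) = 2"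
      using edge[OF uv(1)] G by (simp add: simple_graph_def)
    ultimately have "{u, v} = h u"
      using uv(4) by (intro card_subset_eq) (auto intro: card_ge_0_finite)
    then show False using indep[OF uv(1,2)] edge[OF uv(1)] by simp
  qed
  then have "card S = card (h ` S)" by (simp add: card_image)
  also have "\<dots> \<le> card ((\<Union>v\<in>S. star G v) \<inter> M)"
    using h edge finite_matching[OF G M(1)] by (intro card_mono) (auto simp: star_def)
  finally show "card S \<le> card ((\<Union>v\<in>S. star G v) \<inter> M)" .
qed

lemma card_stars_le:
  assumes "finite S" "\<And>v. v \<in> S \<Longrightarrow> card (star G v) \<le> k"
  shows "card (\<Union>v\<in>S. star G v) \<le> k * card S"
  using card_UN_le[OF assms(1), of "star G"] sum_bounded_above[of S "\<lambda>v. card (star G v)" k]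
    assms(2) by (simp add: mult.commute)

lemma card_star_le:
  assumes G: "simple_graph G" and N: "finite N" "\<And>w. {v, w} \<in> edges G \<Longrightarrow> w \<in> N"
  shows "card (star G v) \<le> card N"
proof -
  have "star G v \<subseteq> (\<lambda>w. {v, w}) ` N"
  proof
    fix e assume "e \<in> star G v"
    then have e: "e \<in> edges G" "v \<in> e" by (auto simp: star_def)
    then have "card e = 2" using G by (simp add: simple_graph_def)
    then obtain w where "e = {v, w}" using e(2) by (auto simp: card_2_iff)
    then show "e \<in> (\<lambda>w. {v, w}) ` N" using e N(2) by auto
  qed
  then show ?thesis by (meson N(1) surj_card_le)
qed

section \<open>Perfect matchings from partner maps\<close>

definition partner_map :: "'a ugraph \<Rightarrow> ('a \<Rightarrow> 'a) \<Rightarrow> bool" where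
  "partner_map G f \<longleftrightarrow>
     (\<forall>v\<in>verts G. f v \<in> verts G \<and> f (f v) = v \<and> {v, f v} \<in> edges G)"

definition pairs :: "'a ugraph \<Rightarrow> ('a \<Rightarrow> 'a) \<Rightarrow> 'a set set" where
  "pairs G f = (\<lambda>v. {v, f v}) ` verts G"

lemma pairs_edge:
  assumes "partner_map G f" "e \<in> pairs G f" "v \<in> e"
  shows "v \<in> verts G" "e = {v, f v}"
  using assms by (auto simp: pairs_def partner_map_def)

lemma perfect_matching_pairs:
  assumes "partner_map G f"
  shows "perfect_matching G (pairs G f)"
  unfolding perfect_matching_def matching_def
proof (intro conjI ballI impI)
  show "pairs G f \<subseteq> edges G" "\<Union>(pairs G f) = verts G"
    using assms by (auto simp: pairs_def partner_map_def)
  fix e e' assume "e \<in> pairs G f" "e' \<in> pairs G f" "e \<noteq> e'"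
  then show "e \<inter> e' = {}" using pairs_edge(2)[OF assms] by blast
qed

lemma pairs_Int_agree:
  assumes "partner_map G f" "partner_map G g" "e \<in> pairs G f" "e \<in> pairs G g" "v \<in> e"
  shows "v \<in> verts G" "f v = g v"
proof -
  show "v \<in> verts G" by (rule pairs_edge(1)[OF assms(1,3,5)])
  have "{v, f v} = {v, g v}"
    using pairs_edge(2)[OF assms(1,3,5)] pairs_edge(2)[OF assms(2,4,5)] by simp
  then show "f v = g v" by (metis doubleton_eq_iff)
qed

lemma pairs_disjoint:
  assumes "partner_map G f" "partner_map G g" "\<And>v. v \<in> verts G \<Longrightarrow> f v \<noteq> g v"
  shows "pairs G f \<inter> pairs G g = {}"
proof (rule ccontr)
  assume "pairs G f \<inter> pairs G g \<noteq> {}"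
  then obtain e where e: "e \<in> pairs G f" "e \<in> pairs G g" by blast
  then obtain v where "v \<in> e" by (auto simp: pairs_def)
  then show False using pairs_Int_agree[OF assms(1,2) e] assms(3) by blast
qed

section \<open>Even cycles\<close>

definition cnext :: "nat \<Rightarrow> nat \<Rightarrow> nat" where
  "cnext n j = (if Suc j = n then 0 else Suc j)"

definition cprev :: "nat \<Rightarrow> nat \<Rightarrow> nat" where
  "cprev n j = (if j = 0 then n - 1 else j - 1)"

text \<open>
  The two perfect matchings of an even cycle: the first consists of the pairs \<open>2k, 2k + 1\<close>, the
  second of the pairs \<open>2k - 1, 2k\<close>, taken modulo \<open>n\<close>.
\<close>

definition even_partner :: "nat \<Rightarrow> nat \<Rightarrow> nat" where
  "even_partner n j = (if even j then cnext n j else cprev n j)"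

definition odd_partner :: "nat \<Rightarrow> nat \<Rightarrow> nat" where
  "odd_partner n j = (if odd j then cnext n j else cprev n j)"

lemma verts_cycle [simp]: "verts (cycle_graph n) = {0..<n}"
  by (simp add: cycle_graph_def)

lemma cnext_less: "j < n \<Longrightarrow> cnext n j < n"
  by (auto simp: cnext_def)

lemma cprev_less: "j < n \<Longrightarrow> cprev n j < n"
  by (auto simp: cprev_def)

lemma cnext_cprev: "j < n \<Longrightarrow> cnext n (cprev n j) = j"
  by (auto simp: cprev_def cnext_def)

lemma cprev_cnext: "j < n \<Longrightarrow> cprev n (cnext n j) = j"
  by (auto simp: cprev_def cnext_def)

lemma parity_cnext: "even n \<Longrightarrow> j < n \<Longrightarrow> even (cnext n j) \<longleftrightarrow> odd j"
  by (auto simp: cnext_def)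

lemma parity_cprev: "even n \<Longrightarrow> j < n \<Longrightarrow> even (cprev n j) \<longleftrightarrow> odd j"
  by (auto simp: cprev_def)

lemma cnext_neq_cprev: "n \<ge> 3 \<Longrightarrow> j < n \<Longrightarrow> cnext n j \<noteq> cprev n j"
  by (auto simp: cprev_def cnext_def)

lemma edge_cycle_iff:
  "{j, l} \<in> edges (cycle_graph n) \<longleftrightarrow> j < n \<and> l < n \<and> (l = cnext n j \<or> l = cprev n j)"
proof -
  have mod: "(j + 1) mod n = cnext n j" if "j < n" for j
    using that by (auto simp: cnext_def)
  have "{j, l} \<in> edges (cycle_graph n) \<longleftrightarrow> (\<exists>i. i < n \<and> {j, l} = {i, (i + 1) mod n})"
    by (auto simp: cycle_graph_def)
  also have "\<dots> \<longleftrightarrow> (\<exists>i. i < n \<and> {j, l} = {i, cnext n i})"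
    by (simp only: mod cong: conj_cong)
  also have "\<dots> \<longleftrightarrow> j < n \<and> l < n \<and> (l = cnext n j \<or> j = cnext n l)"
    by (auto simp: doubleton_eq_iff intro: cnext_less)
  also have "\<dots> \<longleftrightarrow> j < n \<and> l < n \<and> (l = cnext n j \<or> l = cprev n j)"
    using cnext_cprev cprev_cnext by metis
  finally show ?thesis .
qed

lemma even_partner:
  assumes "even n" "j < n"
  shows "even_partner n j < n" "even_partner n (even_partner n j) = j"
    "{j, even_partner n j} \<in> edges (cycle_graph n)"
  using assms
  by (simp_all add: even_partner_def edge_cycle_iff cnext_less cprev_less parity_cnext
      parity_cprev cnext_cprev cprev_cnext)

lemma odd_partner:
  assumes "even n" "j < n"
  shows "odd_partner n j < n" "odd_partner n (odd_partner n j) = j"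
    "{j, odd_partner n j} \<in> edges (cycle_graph n)"
  using assms
  by (simp_all add: odd_partner_def edge_cycle_iff cnext_less cprev_less parity_cnext
      parity_cprev cnext_cprev cprev_cnext)

lemma even_partner_neq_odd_partner:
  "n \<ge> 3 \<Longrightarrow> j < n \<Longrightarrow> even_partner n j \<noteq> odd_partner n j"
  using cnext_neq_cprev[of n j] by (auto simp: even_partner_def odd_partner_def)

theorem tau_cycle:
  assumes n: "even n" "n \<ge> 3" and d: "2 * d \<le> n"
  shows "tau d (cycle_graph n) = 2 * d"
proof -
  let ?G = "cycle_graph n"
  let ?A = "pairs ?G (even_partner n)" and ?B = "pairs ?G (odd_partner n)"
  have G: "simple_graph ?G" using n simple_cycle_graph by simp
  have pA: "partner_map ?G (even_partner n)" and pB: "partner_map ?G (odd_partner n)"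
    using even_partner[OF n(1)] odd_partner[OF n(1)] by (simp_all add: partner_map_def)
  note A = perfect_matching_pairs[OF pA] and B = perfect_matching_pairs[OF pB]
  have disj: "?A \<inter> ?B = {}"
    using even_partner_neq_odd_partner[OF n(2)] by (intro pairs_disjoint pA pB) simp
  define S where "S = (\<lambda>k. 2 * k) ` {0..<d}"
  have card_S: "card S = d" by (simp add: S_def card_image inj_on_def)
  have S: "S \<subseteq> verts ?G" using d by (auto simp: S_def)
  have "{u, v} \<notin> edges ?G" if "u \<in> S" "v \<in> S" for u v
  proof -
    have "even u" "even v" using that by (auto simp: S_def)
    then show ?thesis using parity_cnext[OF n(1)] parity_cprev[OF n(1)] by (auto simp: edge_cycle_iff)
  qed
  from transversal_stars[OF G A S this] have T: "transversal d ?G (\<Union>v\<in>S. star ?G v)"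
    by (simp add: card_S)
  have deg: "card (star ?G v) \<le> 2" for v
    by (rule order_trans[OF card_star_le[OF G, of "{cnext n v, cprev n v}"]])
      (auto simp: edge_cycle_iff card_insert_if)
  have "card (\<Union>v\<in>S. star ?G v) \<le> 2 * d"
    using card_stars_le[of S ?G 2] deg card_S by (simp add: S_def)
  with G T show ?thesis
  proof (rule tau_eqI)
    fix U assume U: "transversal d ?G U"
    have fin: "finite U" using U finite_edges[OF G] by (auto simp: transversal_def intro: finite_subset)
    have "2 * d \<le> card (U \<inter> ?A) + card (U \<inter> ?B)"
      using transversal_perfect_matching[OF G A U] transversal_perfect_matching[OF G B U] by simp
    also have "\<dots> = card ((U \<inter> ?A) \<union> (U \<inter> ?B))"
      using fin disj by (intro card_Un_disjoint[symmetric]) auto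
    also have "\<dots> \<le> card U" by (intro card_mono fin) auto
    finally show "2 * d \<le> card U" .
  qed
qed

section \<open>The grid of an odd path and an even cycle\<close>

abbreviation grid :: "nat \<Rightarrow> nat \<Rightarrow> (nat \<times> nat) ugraph" where
  "grid m n \<equiv> path_graph m \<box> cycle_graph n"

lemma simple_grid: "n \<ge> 3 \<Longrightarrow> simple_graph (grid m n)"
  by (intro simple_cartesian_product simple_path_graph simple_cycle_graph)

lemma verts_grid [simp]: "verts (grid m n) = {0..<m} \<times> {0..<n}"
  by (simp add: cartesian_product_def path_graph_def)

lemma edge_path_iff:
  "{i, k} \<in> edges (path_graph m) \<longleftrightarrow> i < m \<and> k < m \<and> (k = Suc i \<or> i = Suc k)"
  by (auto simp: path_graph_def doubleton_eq_iff)

lemma edge_grid_iff: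
  "{(i, j), (k, l)} \<in> edges (grid m n) \<longleftrightarrow>
     i < m \<and> k < m \<and> j < n \<and> l < n \<and>
     (i = k \<and> (l = cnext n j \<or> l = cprev n j) \<or> (k = Suc i \<or> i = Suc k) \<and> j = l)"
proof -
  have "{(i, j), (k, l)} \<in> edges (grid m n) \<longleftrightarrow>
     i < m \<and> k < m \<and> j < n \<and> l < n \<and>
     (i = k \<and> {j, l} \<in> edges (cycle_graph n) \<or> {i, k} \<in> edges (path_graph m) \<and> j = l)"
    (is "?L \<longleftrightarrow> ?R")
  proof
    assume ?L
    then obtain g1 h1 g2 h2 where *: "{(i, j), (k, l)} = {(g1, h1), (g2, h2)}"
        "g1 < m" "g2 < m" "h1 < n" "h2 < n"
        "g1 = g2 \<and> {h1, h2} \<in> edges (cycle_graph n) \<or> {g1, g2} \<in> edges (path_graph m) \<and> h1 = h2"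
      by (simp add: cartesian_product_def path_graph_def) blast
    have "(i, j) = (g1, h1) \<and> (k, l) = (g2, h2) \<or> (i, j) = (g2, h2) \<and> (k, l) = (g1, h1)"
      using *(1) by (simp only: doubleton_eq_iff)
    then show ?R
      using *(2-) insert_commute[of h1 h2 "{}"] insert_commute[of g1 g2 "{}"] by auto
  next
    assume ?R
    moreover have "edges (grid m n) = {{(g1, h1), (g2, h2)} | g1 h1 g2 h2.
        g1 < m \<and> g2 < m \<and> h1 < n \<and> h2 < n \<and>
        (g1 = g2 \<and> {h1, h2} \<in> edges (cycle_graph n) \<or> {g1, g2} \<in> edges (path_graph m) \<and> h1 = h2)}"
      by (simp add: cartesian_product_def path_graph_def)
    ultimately show ?L by blast
  qed
  then show ?thesis by (auto simp: edge_cycle_iff edge_path_iff)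
qed

text \<open>
  As the number of rows is odd, a perfect matching can use all column edges between the rows
  \<open>2k\<close> and \<open>2k + 1\<close>, which leaves the last row to be matched within itself, or all column
  edges between the rows \<open>2k + 1\<close> and \<open>2k + 2\<close>, which leaves the first row.
\<close>

fun columns_from_first :: "nat \<Rightarrow> nat \<Rightarrow> nat \<times> nat \<Rightarrow> nat \<times> nat" where
  "columns_from_first m n (i, j) =
     (if Suc i = m then (i, even_partner n j) else if even i then (Suc i, j) else (i - 1, j))"

fun columns_from_second :: "nat \<Rightarrow> nat \<Rightarrow> nat \<times> nat \<Rightarrow> nat \<times> nat" where
  "columns_from_second m n (i, j) =
     (if i = 0 then (i, even_partner n j) else if odd i then (Suc i, j) else (i - 1, j))"

fun rows_odd :: "nat \<Rightarrow> nat \<times> nat \<Rightarrow> nat \<times> nat" where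
  "rows_odd n (i, j) = (i, odd_partner n j)"

fun rows_even :: "nat \<Rightarrow> nat \<times> nat \<Rightarrow> nat \<times> nat" where
  "rows_even n (i, j) = (i, even_partner n j)"

lemma partner_map_rows_even: "even n \<Longrightarrow> partner_map (grid m n) (rows_even n)"
  using even_partner[of n] by (auto simp: partner_map_def edge_grid_iff edge_cycle_iff)

lemma partner_map_rows_odd: "even n \<Longrightarrow> partner_map (grid m n) (rows_odd n)"
  using odd_partner[of n] by (auto simp: partner_map_def edge_grid_iff edge_cycle_iff)

lemma partner_map_columns_from_first:
  assumes "odd m" "even n"
  shows "partner_map (grid m n) (columns_from_first m n)"
proof -
  have "Suc i < m" if "even i" "i < m" "Suc i \<noteq> m" for i
    using that by linarith
  then show ?thesis
    using even_partner[OF assms(2)] assms(1)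
    by (auto simp: partner_map_def edge_grid_iff edge_cycle_iff elim!: oddE)
qed

lemma partner_map_columns_from_second:
  assumes "odd m" "even n"
  shows "partner_map (grid m n) (columns_from_second m n)"
proof -
  have "Suc i < m" if "odd i" "i < m" for i
    using that assms(1) by (metis Suc_lessI even_Suc)
  then show ?thesis
    using even_partner[OF assms(2)]
    by (auto simp: partner_map_def edge_grid_iff edge_cycle_iff)
qed

text \<open>
  The three matchings of the first inequality are disjoint. In the second inequality the
  fourth one is added: an edge that it shares with the others lies in a boundary row, and the
  shared edges form a matching within the \<open>2 * n\<close> vertices of these rows, so there are at most \<open>n\<close>.
\<close>

lemma grid_transversal_lower_bounds:
  assumes m: "odd m" "m \<ge> 3" and n: "even n" "n \<ge> 3"
    and T: "transversal d (grid m n) T"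
  shows "3 * d \<le> card T" "4 * d \<le> card T + n"
proof -
  let ?G = "grid m n"
  let ?A = "pairs ?G (columns_from_first m n)" and ?B = "pairs ?G (columns_from_second m n)"
  let ?C = "pairs ?G (rows_odd n)" and ?D = "pairs ?G (rows_even n)"
  note G = simple_grid[OF n(2), of m]
  note pA = partner_map_columns_from_first[OF m(1) n(1)]
    and pB = partner_map_columns_from_second[OF m(1) n(1)]
    and pC = partner_map_rows_odd[OF n(1), of m] and pD = partner_map_rows_even[OF n(1), of m]
  note neq = even_partner_neq_odd_partner[OF n(2)]
  have disj: "?A \<inter> ?B = {}" "?A \<inter> ?C = {}" "?B \<inter> ?C = {}" "?C \<inter> ?D = {}"
  proof -
    show "?A \<inter> ?B = {}" by (rule pairs_disjoint[OF pA pB]) (use m in \<open>auto split: if_splits\<close>)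
    show "?A \<inter> ?C = {}" by (rule pairs_disjoint[OF pA pC]) (use m neq in \<open>auto split: if_splits elim!: oddE\<close>)
    show "?B \<inter> ?C = {}" by (rule pairs_disjoint[OF pB pC]) (use m neq in \<open>auto split: if_splits elim!: oddE\<close>)
    show "?C \<inter> ?D = {}" by (rule pairs_disjoint[OF pC pD]) (use neq in fastforce)
  qed
  have fin: "finite T"
    using T finite_edges[OF G] by (auto simp: transversal_def intro: finite_subset)
  have d: "d \<le> card (T \<inter> pairs ?G f)" if "partner_map ?G f" for f
    by (rule transversal_perfect_matching[OF G perfect_matching_pairs[OF that] T])
  let ?ABC = "(T \<inter> ?A) \<union> (T \<inter> ?B) \<union> (T \<inter> ?C)"
  have ABC: "card ?ABC = card (T \<inter> ?A) + card (T \<inter> ?B) + card (T \<inter> ?C)"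
    using fin disj by (subst card_Un_disjoint; auto)+
  have "card ?ABC \<le> card T" by (intro card_mono fin) auto
  then show "3 * d \<le> card T" using ABC d[OF pA] d[OF pB] d[OF pC] by simp

  \<comment> \<open>The part of \<open>T\<close> that counting with all four matchings counts twice.\<close>
  let ?I = "T \<inter> ?D \<inter> (?A \<union> ?B)"
  have D: "matching ?G ?D"
    using perfect_matching_pairs[OF pD] by (simp add: perfect_matching_def)
  have I: "matching ?G ?I" using D by (auto simp: matching_def)
  have "\<Union>?I \<subseteq> {0, m - 1} \<times> {0..<n}"
  proof
    fix v assume "v \<in> \<Union>?I"
    then obtain e where e: "e \<in> ?D" "e \<in> ?A \<or> e \<in> ?B" "v \<in> e" by auto
    have v: "v \<in> verts ?G" using pairs_edge(1)[OF pD e(1,3)] .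
    have "rows_even n v = columns_from_first m n v \<or> rows_even n v = columns_from_second m n v"
      using e(2) pairs_Int_agree(2)[OF pD pA e(1) _ e(3)] pairs_Int_agree(2)[OF pD pB e(1) _ e(3)]
      by blast
    then show "v \<in> {0, m - 1} \<times> {0..<n}"
      using v by (cases v) (auto split: if_splits)
  qed
  then have "card (\<Union>?I) \<le> card ({0, m - 1} \<times> {0..<n})" by (intro card_mono) auto
  then have cI: "card ?I \<le> n"
    using card_Union_matching[OF G I] m(2) by (simp add: card_cartesian_product)
  have "card (T \<inter> ?D) + card ?ABC = card ((T \<inter> ?D) \<union> ?ABC) + card ((T \<inter> ?D) \<inter> ?ABC)"
    using fin by (intro card_Un_Int) auto
  moreover have "(T \<inter> ?D) \<inter> ?ABC = ?I" using disj(4) by auto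
  moreover have "card ((T \<inter> ?D) \<union> ?ABC) \<le> card T" by (intro card_mono fin) auto
  ultimately show "4 * d \<le> card T + n"
    using ABC cI d[OF pA] d[OF pB] d[OF pC] d[OF pD] by simp
qed

lemma card_star_grid_le:
  assumes "n \<ge> 3"
  shows "card (star (grid m n) (i, j)) \<le> 4"
proof -
  have "card (star (grid m n) (i, j))
      \<le> card {(i, cnext n j), (i, cprev n j), (Suc i, j), (i - 1, j)}"
    by (rule card_star_le[OF simple_grid[OF assms]]) (auto simp: edge_grid_iff)
  also have "\<dots> \<le> 4" by (simp add: card_insert_if)
  finally show ?thesis .
qed

lemma card_star_grid_boundary_le:
  assumes "n \<ge> 3" "i = 0 \<or> Suc i = m"
  shows "card (star (grid m n) (i, j)) \<le> 3"
proof -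
  \<comment> \<open>A boundary row has only one neighbouring row.\<close>
  have "card (star (grid m n) (i, j))
      \<le> card {(i, cnext n j), (i, cprev n j), (if i = 0 then 1 else i - 1, j)}"
    by (rule card_star_le[OF simple_grid[OF assms(1)]])
      (use assms(2) in \<open>auto simp: edge_grid_iff\<close>)
  also have "\<dots> \<le> 3" by (simp add: card_insert_if)
  finally show ?thesis .
qed

text \<open>An enumeration of the vertices \<open>(i, j)\<close> with \<open>i + j\<close> even, a colour class of the grid.\<close>

definition even_vertex :: "nat \<times> nat \<Rightarrow> nat \<times> nat" where
  "even_vertex = (\<lambda>(i, k). (i, 2 * k + i mod 2))"

lemma inj_even_vertex: "inj even_vertex"
  by (auto simp: inj_def even_vertex_def)

lemma even_vertices_transversal:
  assumes m: "odd m" and n: "even n" "n \<ge> 3" and K: "K \<subseteq> {0..<m} \<times> {0..<n div 2}"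
  shows "transversal (card K) (grid m n) (\<Union>v\<in>even_vertex ` K. star (grid m n) v)"
proof -
  have "even_vertex ` K \<subseteq> verts (grid m n)"
  proof -
    have "2 * k + i mod 2 < n" if "k < n div 2" for i k :: nat
      using that n(1) by presburger
    then show ?thesis using K by (auto simp: even_vertex_def)
  qed
  moreover have "{u, v} \<notin> edges (grid m n)" if uv: "u \<in> even_vertex ` K" "v \<in> even_vertex ` K" for u v
  proof -
    obtain i j k l where *: "u = (i, j)" "v = (k, l)" by (metis surj_pair)
    have "even (i + j)" "even (k + l)"
      using uv by (auto simp: * even_vertex_def)
    then show ?thesis
      using parity_cnext[OF n(1), of j] parity_cprev[OF n(1), of j]
      by (auto simp: * edge_grid_iff)
  qed
  ultimately have "transversal (card (even_vertex ` K)) (grid m n)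
      (\<Union>v\<in>even_vertex ` K. star (grid m n) v)"
    by (intro transversal_stars[OF simple_grid[OF n(2)]
          perfect_matching_pairs[OF partner_map_rows_even[OF n(1)]]])
  then show ?thesis by (simp add: card_image inj_on_subset[OF inj_even_vertex])
qed

lemma card_boundary_stars_le:
  assumes "n \<ge> 3" "m > 0" "K \<subseteq> {0, m - 1} \<times> {0..<n div 2}"
  shows "card (\<Union>v\<in>even_vertex ` K. star (grid m n) v) \<le> 3 * card K"
proof -
  have fin: "finite K" using assms(3) by (rule finite_subset) simp
  have "card (star (grid m n) v) \<le> 3" if "v \<in> even_vertex ` K" for v
    using that assms by (auto simp: even_vertex_def intro!: card_star_grid_boundary_le)
  then have "card (\<Union>v\<in>even_vertex ` K. star (grid m n) v) \<le> 3 * card (even_vertex ` K)"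
    using fin by (intro card_stars_le) auto
  then show ?thesis by (simp add: card_image inj_on_subset[OF inj_even_vertex])
qed

theorem tau_grid_small:
  assumes m: "odd m" "m \<ge> 3" and n: "even n" "n \<ge> 3" and d: "d \<le> n"
  shows "tau d (grid m n) = 3 * d"
proof -
  let ?K = "{0, m - 1} \<times> {0..<n div 2}"
  have "card ?K = n" using m n by (auto simp: card_cartesian_product elim!: evenE)
  then obtain K where K: "K \<subseteq> ?K" "card K = d"
    using d obtain_subset_with_card_n by metis
  have "?K \<subseteq> {0..<m} \<times> {0..<n div 2}" using m by auto
  then have KA: "K \<subseteq> {0..<m} \<times> {0..<n div 2}" using K(1) by (rule subset_trans[rotated])
  have "transversal d (grid m n) (\<Union>v\<in>even_vertex ` K. star (grid m n) v)"
    using even_vertices_transversal[OF m(1) n KA] K(2) by simp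
  moreover have "card (\<Union>v\<in>even_vertex ` K. star (grid m n) v) \<le> 3 * d"
    using card_boundary_stars_le[of n m K] K m n by simp
  ultimately show ?thesis
    by (rule tau_eqI[OF simple_grid[OF n(2)]]) (rule grid_transversal_lower_bounds(1)[OF m n])
qed

theorem tau_grid_large:
  assumes m: "odd m" "m \<ge> 3" and n: "even n" "n \<ge> 3" and d: "n \<le> d" "2 * d \<le> m * n"
  shows "tau d (grid m n) = 4 * d - n"
proof -
  let ?B = "{0, m - 1} \<times> {0..<n div 2}" and ?A = "{0..<m} \<times> {0..<n div 2}"
  have cB: "card ?B = n" using m n by (auto simp: card_cartesian_product elim!: evenE)
  have "2 * card ?A = m * n" using n(1) by (auto simp: card_cartesian_product elim!: evenE)
  then have "d \<le> card ?A" using d by linarith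
  moreover have "?B \<subseteq> ?A" using m by auto
  ultimately obtain K where K: "?B \<subseteq> K" "K \<subseteq> ?A" "card K = d"
    using exists_subset_between[of ?B d ?A] cB d(1) by auto
  let ?St = "\<lambda>L. \<Union>v\<in>even_vertex ` L. star (grid m n) v"
  have T: "transversal d (grid m n) (?St K)"
    using even_vertices_transversal[OF m(1) n K(2)] K(3) by simp
  have finK: "finite K" using K(2) by (rule finite_subset) simp
  have "card (K - ?B) = d - n" using K cB by (subst card_Diff_subset) auto
  then have "card (even_vertex ` (K - ?B)) = d - n"
    by (simp add: card_image inj_on_subset[OF inj_even_vertex])
  then have "card (?St (K - ?B)) \<le> 4 * (d - n)"
    using card_stars_le[of "even_vertex ` (K - ?B)" "grid m n" 4] finK card_star_grid_le[OF n(2)]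
    by fastforce
  moreover have "card (?St ?B) \<le> 3 * n"
    using card_boundary_stars_le[of n m ?B] cB m n by simp
  moreover have "?St K = ?St ?B \<union> ?St (K - ?B)" using K(1) by blast
  then have "card (?St K) \<le> card (?St ?B) + card (?St (K - ?B))" by (metis card_Un_le)
  ultimately have "card (?St K) \<le> 4 * d - n" using d(1) by linarith
  with simple_grid[OF n(2)] T show ?thesis
  proof (rule tau_eqI)
    fix U assume "transversal d (grid m n) U"
    then show "4 * d - n \<le> card U"
      using grid_transversal_lower_bounds(2)[OF m n] by fastforce
  qed
qed

theorem theorem3p7:
  fixes m n d :: nat
  assumes "odd m" and "m > 0" and "even n"
  shows "(n \<ge> 4 \<longrightarrow> 1 \<le> d \<and> real d \<le> real n / 2 \<longrightarrow>
            tau d (cycle_graph n) = 2 * d) \<and>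
         (m \<ge> 3 \<and> n \<ge> 4 \<longrightarrow> 1 \<le> d \<and> d \<le> n \<longrightarrow>
            tau d (path_graph m \<box> cycle_graph n) = 3 * d) \<and>
         (m \<ge> 3 \<and> n \<ge> 4 \<longrightarrow> n + 1 \<le> d \<and> real d \<le> real (m * n) / 2 \<longrightarrow>
            int (tau d (path_graph m \<box> cycle_graph n)) = 4 * int d - int n)"
proof (intro conjI impI)
  assume "n \<ge> 4" "1 \<le> d \<and> real d \<le> real n / 2"
  then show "tau d (cycle_graph n) = 2 * d"
    using assms by (intro tau_cycle) linarith+
next
  assume "m \<ge> 3 \<and> n \<ge> 4" "1 \<le> d \<and> d \<le> n"
  then show "tau d (path_graph m \<box> cycle_graph n) = 3 * d"
    using assms by (intro tau_grid_small) auto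
next
  assume mn: "m \<ge> 3 \<and> n \<ge> 4" and d: "n + 1 \<le> d \<and> real d \<le> real (m * n) / 2"
  have "real (2 * d) \<le> real (m * n)" using d by linarith
  then have "2 * d \<le> m * n" by (simp only: of_nat_le_iff)
  then have "tau d (path_graph m \<box> cycle_graph n) = 4 * d - n"
    using tau_grid_large[of m n d] assms mn d by simp
  then show "int (tau d (path_graph m \<box> cycle_graph n)) = 4 * int d - int n"
    using d by simp
qed

end
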